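(* Assume that for every $r\geq 2$ and every even $g\geq 4$, every $(r,g)$-cage is bipartite. Then for every $r\geq 2$ and every $g\geq 3$ there exists an $(r,g,3)$-equitable graph.
   Context: All graphs are finite and simple. An $(r,g)$-graph is an $r$-regular graph with girth exactly $g$; an $(r,g)$-cage is an $(r,g)$-graph with the minimum possible number of vertices. For integers $r\geq 2$, $g\geq 3$, $\chi\geq 2$, an $(r,g,\chi)$-graph is an $r$-regular graph with girth exactly $g$ and chromatic number exactly $\chi$. A proper vertex coloring is equitable if the sizes of any two color classes differ by at most one. An $(r,g,\chi)$-equitable graph is an $(r,g,\chi)$-graph admitting an equitable proper coloring with $\chi$ colors. *)

theory Defs
  imports Main
begin

definition sgraph :: "'a set \<Rightarrow> ('a \<Rightarrow> 'a \<Rightarrow> bool) \<Rightarrow> bool" where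
  "sgraph V E \<longleftrightarrow> finite V \<and> (\<forall>x y. E x y \<longrightarrow> x \<in> V \<and> y \<in> V)
     \<and> (\<forall>x y. E x y \<longrightarrow> E y x) \<and> (\<forall>x. \<not> E x x)"

definition regular :: "'a set \<Rightarrow> ('a \<Rightarrow> 'a \<Rightarrow> bool) \<Rightarrow> nat \<Rightarrow> bool" where
  "regular V E r \<longleftrightarrow> (\<forall>v\<in>V. card {u\<in>V. E v u} = r)"

definition is_cycle :: "'a set \<Rightarrow> ('a \<Rightarrow> 'a \<Rightarrow> bool) \<Rightarrow> 'a list \<Rightarrow> bool" where
  "is_cycle V E cs \<longleftrightarrow> length cs \<ge> 3 \<and> distinct cs \<and> set cs \<subseteq> V
     \<and> (\<forall>i. Suc i < length cs \<longrightarrow> E (cs ! i) (cs ! Suc i))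
     \<and> E (last cs) (hd cs)"

definition has_girth :: "'a set \<Rightarrow> ('a \<Rightarrow> 'a \<Rightarrow> bool) \<Rightarrow> nat \<Rightarrow> bool" where
  "has_girth V E g \<longleftrightarrow> (\<exists>cs. is_cycle V E cs \<and> length cs = g)
     \<and> (\<forall>cs. is_cycle V E cs \<longrightarrow> g \<le> length cs)"

definition proper_coloring :: "'a set \<Rightarrow> ('a \<Rightarrow> 'a \<Rightarrow> bool) \<Rightarrow> nat \<Rightarrow> ('a \<Rightarrow> nat) \<Rightarrow> bool" where
  "proper_coloring V E k c \<longleftrightarrow> (\<forall>v\<in>V. c v < k) \<and> (\<forall>x\<in>V. \<forall>y\<in>V. E x y \<longrightarrow> c x \<noteq> c y)"

definition colorable :: "'a set \<Rightarrow> ('a \<Rightarrow> 'a \<Rightarrow> bool) \<Rightarrow> nat \<Rightarrow> bool" where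
  "colorable V E k \<longleftrightarrow> (\<exists>c. proper_coloring V E k c)"

definition chromatic_number_eq :: "'a set \<Rightarrow> ('a \<Rightarrow> 'a \<Rightarrow> bool) \<Rightarrow> nat \<Rightarrow> bool" where
  "chromatic_number_eq V E k \<longleftrightarrow> colorable V E k \<and> \<not> colorable V E (k - 1)"

definition equitable_coloring :: "'a set \<Rightarrow> ('a \<Rightarrow> 'a \<Rightarrow> bool) \<Rightarrow> nat \<Rightarrow> ('a \<Rightarrow> nat) \<Rightarrow> bool" where
  "equitable_coloring V E k c \<longleftrightarrow> proper_coloring V E k c
     \<and> (\<forall>i<k. \<forall>j<k. card {v\<in>V. c v = i} \<le> card {v\<in>V. c v = j} + 1)"

definition bipartite :: "'a set \<Rightarrow> ('a \<Rightarrow> 'a \<Rightarrow> bool) \<Rightarrow> bool" where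
  "bipartite V E \<longleftrightarrow> (\<exists>A \<subseteq> V. \<forall>x\<in>V. \<forall>y\<in>V. E x y \<longrightarrow> (x \<in> A \<longleftrightarrow> y \<notin> A))"

definition rg_graph :: "'a set \<Rightarrow> ('a \<Rightarrow> 'a \<Rightarrow> bool) \<Rightarrow> nat \<Rightarrow> nat \<Rightarrow> bool" where
  "rg_graph V E r g \<longleftrightarrow> sgraph V E \<and> regular V E r \<and> has_girth V E g"

text \<open>Cages are taken among graphs with vertices in nat (every finite graph
  is isomorphic to such a graph).\<close>
definition cage :: "nat set \<Rightarrow> (nat \<Rightarrow> nat \<Rightarrow> bool) \<Rightarrow> nat \<Rightarrow> nat \<Rightarrow> bool" where
  "cage V E r g \<longleftrightarrow> rg_graph V E r g
     \<and> (\<forall>(V' :: nat set) E'. rg_graph V' E' r g \<longrightarrow> card V \<le> card V')"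

definition rgchi_graph :: "'a set \<Rightarrow> ('a \<Rightarrow> 'a \<Rightarrow> bool) \<Rightarrow> nat \<Rightarrow> nat \<Rightarrow> nat \<Rightarrow> bool" where
  "rgchi_graph V E r g k \<longleftrightarrow> rg_graph V E r g \<and> chromatic_number_eq V E k"

definition rgchi_equitable :: "'a set \<Rightarrow> ('a \<Rightarrow> 'a \<Rightarrow> bool) \<Rightarrow> nat \<Rightarrow> nat \<Rightarrow> nat \<Rightarrow> bool" where
  "rgchi_equitable V E r g k \<longleftrightarrow> rgchi_graph V E r g k \<and> (\<exists>c. equitable_coloring V E k c)"

end

theory Submission
  imports Defs "HOL-Combinatorics.Permutations"
begin

text \<open>Start with disjoint cycles of lengths \<open>g\<close> and \<open>g + 1\<close>, three copies of each with the
  colours rotated: a 2-regular graph of girth \<open>g\<close> with an odd cycle and a balanced 3-colouring.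
  To raise the degree by \<open>k\<close>, take copies of the graph indexed by a bipartite graph of girth
  above \<open>g\<close> whose edges are properly coloured by the letters \<open>(v, i)\<close>, and let an edge with letter
  \<open>(v, i)\<close> join the two copies of \<open>v\<close>; rotating the colours in one part of the index
  graph keeps the colouring proper. The index graph is Biggs' construction: each letter acts as an
  involution on the reduced words of length at most \<open>g\<close> (a ball in the regular tree), and the
  permutations generated have no short relations.\<close>

section \<open>Cycles\<close>

lemma is_cycle_map:
  assumes "is_cycle V E cs" "inj_on h (set cs)" "h ` set cs \<subseteq> V'"
    and "\<And>x y. x \<in> set cs \<Longrightarrow> y \<in> set cs \<Longrightarrow> E x y \<Longrightarrow> E' (h x) (h y)"
  shows "is_cycle V' E' (map h cs)"
proof -
  have "cs \<noteq> []" using assms(1) by (auto simp: is_cycle_def)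
  then show ?thesis
    using assms by (auto simp: is_cycle_def distinct_map last_map hd_map)
qed

text \<open>Reading positions modulo the length turns the closing edge into an ordinary step, so a
  walk around the cycle may start anywhere and wrap around.\<close>

lemma is_cycle_periodic:
  assumes "is_cycle V E cs"
  obtains p where "\<And>i. p i \<in> set cs" "\<And>i. E (p i) (p (Suc i))"
    "\<And>i j. p i = p j \<longleftrightarrow> i mod length cs = j mod length cs" "set cs = range p"
proof
  let ?n = "length cs" and ?p = "\<lambda>i. cs ! (i mod length cs)"
  have n: "?n \<ge> 3" "distinct cs" using assms by (auto simp: is_cycle_def)
  then have lt: "i mod ?n < ?n" for i by (intro mod_less_divisor) linarith
  show "?p i \<in> set cs" for i using lt by simp
  show "E (?p i) (?p (Suc i))" for i
  proof (cases "Suc (i mod ?n) = ?n")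
    case True
    then have "Suc i mod ?n = 0" "i mod ?n = ?n - 1" by (auto simp: mod_Suc)
    moreover have "cs \<noteq> []" using n by auto
    ultimately show ?thesis
      using assms n by (simp add: is_cycle_def last_conv_nth hd_conv_nth)
  next
    case False
    then have "Suc i mod ?n = Suc (i mod ?n)" by (simp add: mod_Suc)
    with False lt[of i] show ?thesis using assms by (simp add: is_cycle_def)
  qed
  show "?p i = ?p j \<longleftrightarrow> i mod ?n = j mod ?n" for i j
    using n lt by (simp add: nth_eq_iff_index_eq)
  show "set cs = range ?p"
  proof
    show "set cs \<subseteq> range ?p"
    proof
      fix x assume "x \<in> set cs"
      then obtain i where "i < ?n" "cs ! i = x" by (auto simp: in_set_conv_nth)
      then show "x \<in> range ?p" by (intro image_eqI[of _ _ i]) auto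
    qed
  qed (use lt in auto)
qed

lemma is_cycle_two_neighbours:
  assumes "sgraph V E" "is_cycle V E cs" "v \<in> set cs"
  obtains u w where "u \<in> set cs" "w \<in> set cs" "u \<noteq> w" "E v u" "E v w"
proof -
  let ?n = "length cs"
  obtain p where p: "\<And>i. p i \<in> set cs" "\<And>i. E (p i) (p (Suc i))"
    "\<And>i j. p i = p j \<longleftrightarrow> i mod ?n = j mod ?n" "set cs = range p"
    using is_cycle_periodic[OF assms(2)] by blast
  have n: "?n \<ge> 3" using assms(2) by (simp add: is_cycle_def)
  obtain i where i: "v = p i" using p(4) assms(3) by auto
  \<comment> \<open>The predecessor of \<open>i\<close> modulo the length, written so that the
    subtraction never truncates at \<open>i = 0\<close>.\<close>
  let ?j = "i + ?n - 1"
  have "Suc ?j = i + ?n" using n by linarith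
  then have "Suc ?j mod ?n = i mod ?n" by simp
  then have "p (Suc ?j) = v" using p(3) i by blast
  then have "E v (p ?j)" using p(2)[of ?j] assms(1) by (auto simp: sgraph_def)
  moreover have "E v (p (Suc i))" using p(2) i by simp
  moreover have "p (Suc i) \<noteq> p ?j"
  proof
    assume "p (Suc i) = p ?j"
    then have "?n dvd ?j - Suc i" using n p(3)[of "Suc i" ?j] mod_eq_dvd_iff_nat[of "Suc i" ?j ?n] by simp
    then have "?n dvd ?n - 2" by simp
    then show False using n by (auto dest: dvd_imp_le)
  qed
  ultimately show thesis using that p(1) by metis
qed

text \<open>The two neighbours of \<open>v\<close> on the cycle already exhaust its degree, so no
  edge leaves the vertex set of the cycle.\<close>

lemma is_cycle_closed_if_2_regular:
  assumes "sgraph V E" "regular V E 2" "is_cycle V E cs" "v \<in> set cs" "E v x"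
  shows "x \<in> set cs"
proof -
  obtain u w where uw: "u \<in> set cs" "w \<in> set cs" "u \<noteq> w" "E v u" "E v w"
    using is_cycle_two_neighbours[OF assms(1,3,4)] by blast
  have sub: "{u, w} \<subseteq> {y \<in> V. E v y}" and v: "v \<in> V"
    using uw assms(1) by (auto simp: sgraph_def)
  have fin: "finite {y \<in> V. E v y}" using assms(1) by (simp add: sgraph_def)
  have "card {y \<in> V. E v y} = card {u, w}"
    using assms(2) v uw(3) by (simp add: regular_def)
  then have "{u, w} = {y \<in> V. E v y}" using card_subset_eq[OF fin sub] by simp
  moreover have "x \<in> {y \<in> V. E v y}" using assms(1,5) by (auto simp: sgraph_def)
  ultimately show ?thesis using uw by auto
qed

section \<open>Reduced words\<close>

definition words :: "'a set \<Rightarrow> nat \<Rightarrow> 'a list set" where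
  "words A R = {w. distinct_adj w \<and> set w \<subseteq> A \<and> length w \<le> R}"

text \<open>Left multiplication by the generator \<open>a\<close> in a free product of groups of
  order two, cut off at length \<open>R\<close>: a word that would leave the ball stays fixed. Lists
  outside the ball are fixed too, as \<open>permutes\<close> demands.\<close>

definition push :: "'a set \<Rightarrow> nat \<Rightarrow> 'a \<Rightarrow> 'a list \<Rightarrow> 'a list" where
  "push A R a w = (if w \<notin> words A R then w
     else if w \<noteq> [] \<and> hd w = a then tl w
     else if length w < R then a # w else w)"

lemma finite_words: "finite A \<Longrightarrow> finite (words A R)"
  by (rule finite_subset[OF _ finite_lists_length_le[of A R]]) (auto simp: words_def)

lemma Nil_in_words [simp]: "[] \<in> words A R"
  by (simp add: words_def)

text \<open>The cut-off does no harm: words of length \<open>R\<close> not starting with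
  \<open>a\<close> are fixed, and the remaining words of the ball are paired as \<open>w\<close> and
  \<open>a # w\<close>.\<close>

lemma push_push: "a \<in> A \<Longrightarrow> push A R a (push A R a w) = w"
  by (cases w) (auto simp: push_def words_def distinct_adj_Cons split: if_splits)

lemma push_permutes: "a \<in> A \<Longrightarrow> push A R a permutes words A R"
  unfolding permutes_def by (metis push_def push_push)

lemma push_Nil: "0 < R \<Longrightarrow> push A R a [] = [a]"
  by (simp add: push_def)

lemma push_Cons:
  "a # w \<in> words A R \<Longrightarrow> length (a # w) < R \<Longrightarrow> b \<noteq> a \<Longrightarrow> push A R b (a # w) = b # a # w"
  by (simp add: push_def)

section \<open>Raising the degree\<close>

text \<open>Taking all permutations of the ball, not just the group generated by the letters, gives
  finiteness and closure under \<open>mate\<close> at once. The Boolean makes the index graph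
  bipartite by construction.\<close>

definition fibre :: "'a set \<Rightarrow> nat \<Rightarrow> (('a list \<Rightarrow> 'a list) \<times> bool) set" where
  "fibre A R = {\<pi>. \<pi> permutes words A R} \<times> UNIV"

definition mate ::
  "'a set \<Rightarrow> nat \<Rightarrow> 'a \<Rightarrow> ('a list \<Rightarrow> 'a list) \<times> bool \<Rightarrow> ('a list \<Rightarrow> 'a list) \<times> bool" where
  "mate A R a x = (push A R a \<circ> fst x, \<not> snd x)"

text \<open>Letters are pairs \<open>(v, i)\<close>, so a letter determines the base vertex over
  which its vertical edges lie; the girth argument depends on this.\<close>

definition lift_edge ::
  "'a set \<Rightarrow> ('a \<Rightarrow> 'a \<Rightarrow> bool) \<Rightarrow> nat \<Rightarrow> nat \<Rightarrow>
   'a \<times> (('a \<times> nat) list \<Rightarrow> ('a \<times> nat) list) \<times> bool \<Rightarrow>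
   'a \<times> (('a \<times> nat) list \<Rightarrow> ('a \<times> nat) list) \<times> bool \<Rightarrow> bool" where
  "lift_edge V E k R = (\<lambda>(v, x) (w, y). x \<in> fibre (V \<times> {..<k}) R \<and>
     (E v w \<and> x = y \<or> v \<in> V \<and> v = w \<and> (\<exists>i<k. y = mate (V \<times> {..<k}) R (v, i) x)))"

lemma finite_fibre: "finite A \<Longrightarrow> finite (fibre A R)"
  by (simp add: fibre_def finite_words finite_permutations)

lemma id_in_fibre: "(id, False) \<in> fibre A R"
  by (simp add: fibre_def permutes_id)

lemma mate_in_fibre: "a \<in> A \<Longrightarrow> x \<in> fibre A R \<Longrightarrow> mate A R a x \<in> fibre A R"
  by (auto simp: mate_def fibre_def intro: permutes_compose push_permutes)

lemma mate_mate: "a \<in> A \<Longrightarrow> mate A R a (mate A R a x) = x"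
  by (cases x) (auto simp: mate_def push_push)

lemma snd_mate: "snd (mate A R a x) = (\<not> snd x)"
  by (simp add: mate_def)

lemma mate_neq: "mate A R a x \<noteq> x" "x \<noteq> mate A R a x"
  using snd_mate by metis+

text \<open>Evaluating at the preimage of the empty word exposes the letter, since
  \<open>push\<close> turns \<open>[]\<close> into \<open>[a]\<close>.\<close>

lemma mate_inject:
  assumes "0 < R" "x \<in> fibre A R" "mate A R a x = mate A R b x"
  shows "a = b"
proof -
  have "fst x permutes words A R" using assms(2) by (auto simp: fibre_def)
  then obtain e where "fst x e = []" by (metis permutes_surj surjD)
  then have "push A R a [] = push A R b []"
    using assms(3) by (auto simp: mate_def dest: fun_cong[of _ _ e])
  then show ?thesis using push_Nil[OF assms(1)] by (metis list.inject)
qed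

section \<open>Simplicity and regularity of the lift\<close>

lemma sgraph_lift:
  assumes "sgraph V E"
  shows "sgraph (V \<times> fibre (V \<times> {..<k}) R) (lift_edge V E k R)"
proof -
  let ?A = "V \<times> {..<k}"
  have "finite (fibre ?A R)" using assms by (intro finite_fibre) (simp add: sgraph_def)
  moreover have "lift_edge V E k R (w, y) (v, x)" if edge: "lift_edge V E k R (v, x) (w, y)" for v x w y
  proof -
    consider "x \<in> fibre ?A R" "E v w" "x = y"
      | i where "x \<in> fibre ?A R" "v \<in> V" "v = w" "i < k" "y = mate ?A R (v, i) x"
      using edge unfolding lift_edge_def prod.case by blast
    then show ?thesis
    proof cases
      case 1
      then show ?thesis using assms by (simp add: lift_edge_def sgraph_def)
    next
      case (2 i)
      then have "x = mate ?A R (w, i) y" "y \<in> fibre ?A R"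
        by (simp_all add: mate_mate mate_in_fibre)
      then show ?thesis using 2 by (auto simp: lift_edge_def)
    qed
  qed
  moreover have "v \<in> V \<and> x \<in> fibre ?A R \<and> w \<in> V \<and> y \<in> fibre ?A R"
    if "lift_edge V E k R (v, x) (w, y)" for v x w y
    using that assms by (auto simp: lift_edge_def sgraph_def mate_in_fibre)
  moreover have "\<not> lift_edge V E k R (v, x) (v, x)" for v x
    using assms by (simp add: lift_edge_def sgraph_def mate_neq)
  ultimately show ?thesis
    using assms unfolding sgraph_def split_paired_All mem_Sigma_iff by blast
qed

lemma regular_lift:
  assumes "sgraph V E" "regular V E d" "0 < R"
  shows "regular (V \<times> fibre (V \<times> {..<k}) R) (lift_edge V E k R) (d + k)"
  unfolding regular_def
proof
  let ?A = "V \<times> {..<k}"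
  fix p assume "p \<in> V \<times> fibre ?A R"
  then obtain v x where p: "p = (v, x)" "v \<in> V" "x \<in> fibre ?A R" by auto
  let ?N = "{q \<in> V \<times> fibre ?A R. lift_edge V E k R p q}"
  let ?N1 = "(\<lambda>u. (u, x)) ` {u \<in> V. E v u}"
  let ?N2 = "(\<lambda>i. (v, mate ?A R (v, i) x)) ` {..<k}"
  have "?N = ?N1 \<union> ?N2"
    using p by (auto simp: lift_edge_def mate_in_fibre)
  moreover have "?N1 \<inter> ?N2 = {}" by (auto simp: mate_neq)
  moreover have "card ?N1 = d"
    using assms(2) p by (subst card_image) (auto simp: inj_on_def regular_def)
  moreover have "card ?N2 = k"
    using mate_inject[OF assms(3) p(3)] by (subst card_image) (auto simp: inj_on_def)
  moreover have "finite ?N1" using assms(1) by (simp add: sgraph_def)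
  ultimately show "card ?N = d + k" by (simp add: card_Un_disjoint)
qed

section \<open>Cycles and girth of the lift\<close>

lemma lift_edgeE:
  assumes "lift_edge V E k R p q"
  obtains (horizontal) "E (fst p) (fst q)" "snd p = snd q"
  | (vertical) a where "a \<in> V \<times> {..<k}" "fst a = fst p" "fst a = fst q"
      "snd q = mate (V \<times> {..<k}) R a (snd p)"
proof -
  obtain v x w y where pq: "p = (v, x)" "q = (w, y)" by (cases p, cases q) blast
  from assms consider "E v w" "x = y"
    | i where "v \<in> V" "v = w" "i < k" "y = mate (V \<times> {..<k}) R (v, i) x"
    unfolding lift_edge_def pq prod.case by blast
  then show thesis
  proof cases
    case 1
    then show thesis using horizontal pq by simp
  next
    case (2 i)
    then show thesis using vertical[of "(v, i)"] pq by simp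
  qed
qed

text \<open>Along a cycle that starts with a vertical edge, the permutation coordinate, applied to the
  word that it sends to the empty word at the start, traces a reduced word: reading the same letter
  twice in a row would mean traversing a vertical edge back. Hence the word grows up to length
  \<open>R\<close>, and the cycle cannot close up before.\<close>
lemma lift_cycle_length:
  assumes "sgraph V E" "is_cycle (V \<times> fibre (V \<times> {..<k}) R) (lift_edge V E k R) cs"
    and nc: "\<not> (\<forall>p\<in>set cs. \<forall>q\<in>set cs. snd p = snd q)"
  shows "R < length cs"
proof (rule ccontr)
  let ?A = "V \<times> {..<k}" and ?n = "length cs"
  let ?L = "lift_edge V E k R"
  assume "\<not> R < ?n"
  then have nR: "?n \<le> R" by simp
  have n: "?n \<ge> 3" and sub: "set cs \<subseteq> V \<times> fibre ?A R"
    using assms(2) by (auto simp: is_cycle_def)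
  obtain p where p: "\<And>i. p i \<in> set cs" "\<And>i. ?L (p i) (p (Suc i))"
    "\<And>i j. p i = p j \<longleftrightarrow> i mod ?n = j mod ?n" "set cs = range p"
    using is_cycle_periodic[OF assms(2)] by blast
  obtain i0 where i0: "snd (p i0) \<noteq> snd (p (Suc i0))"
  proof (rule ccontr)
    assume "\<not> thesis"
    then have "snd (p i) = snd (p (Suc i))" for i using that by blast
    then have "snd (p i) = snd (p 0)" for i by (induction i) auto
    then have "\<forall>x\<in>set cs. snd x = snd (p 0)" using p(4) by (metis rangeE)
    then show False using nc by metis
  qed
  \<comment> \<open>Rotate the cycle so that its first edge is one that changes the fibre
    coordinate.\<close>
  define q where "q i = p (i0 + i)" for i
  have q_edge: "?L (q i) (q (Suc i))" for i using p(2) by (simp add: q_def)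
  have q_neq: "q i \<noteq> q j" if "i < j" "j < i + ?n" for i j
  proof
    assume "q i = q j"
    then have "?n dvd (i0 + j) - (i0 + i)"
      using that p(3) mod_eq_dvd_iff_nat[of "i0 + i" "i0 + j" ?n] by (simp add: q_def)
    then show False using that by (auto dest: dvd_imp_le)
  qed
  have pair: "q i = (u, y)" if "u = fst (q i)" "y = snd (q i)" for i u y
    using that by simp
  have q_n: "q ?n = q 0" using p(3) by (simp add: q_def)
  have perm: "fst (snd (q i)) permutes words ?A R" for i
  proof -
    have "q i \<in> V \<times> fibre ?A R" using p(1) sub by (auto simp: q_def)
    then show ?thesis by (auto simp: fibre_def)
  qed
  obtain e where e: "fst (snd (q 0)) e = []" by (metis perm permutes_surj surjD)
  have e_in: "e \<in> words ?A R" using e permutes_in_image[OF perm[of 0], of e] by simp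
  have in_words: "fst (snd (q i)) e \<in> words ?A R" for i
    using e_in permutes_in_image[OF perm[of i], of e] by simp
  \<comment> \<open>After \<open>i\<close> steps, the last vertical edge was the one into
    \<open>q j\<close>; its letter \<open>a\<close> heads the traced word. Only horizontal edges
    follow it, so \<open>q j\<close> still has the fibre coordinate of \<open>q i\<close>.\<close>
  define inv where "inv i \<longleftrightarrow> (\<exists>j a w. 1 \<le> j \<and> j \<le> i \<and> a \<in> ?A \<and>
      fst (snd (q i)) e = a # w \<and> length (a # w) \<le> i \<and>
      q j = (fst a, snd (q i)) \<and> q (j - 1) = (fst a, mate ?A R a (snd (q i))))" for i
  have step1: "inv 1"
  proof -
    have "snd (q 0) \<noteq> snd (q 1)" using i0 by (simp add: q_def)
    then obtain a where a: "a \<in> ?A" "fst a = fst (q 0)" "fst a = fst (q 1)"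
      "snd (q 1) = mate ?A R a (snd (q 0))"
      using q_edge[of 0, folded One_nat_def] by (elim lift_edgeE) auto
    then have "q 0 = (fst a, mate ?A R a (snd (q 1)))" "q 1 = (fst a, snd (q 1))"
      by (intro pair; simp add: a mate_mate[OF a(1)])+
    moreover have "fst (snd (q 1)) e = [a]"
      unfolding a(4) using e nR n by (simp add: mate_def push_Nil)
    ultimately show ?thesis unfolding inv_def using a(1)
      by (intro exI[of _ 1] exI[of _ a] exI[of _ "[]"]) simp
  qed
  have step: "inv (Suc i)" if i: "1 \<le> i" "i < ?n" and "inv i" for i
  proof -
    obtain j a w where inv: "1 \<le> j" "j \<le> i" "a \<in> ?A" "fst (snd (q i)) e = a # w"
      "length (a # w) \<le> i" "q j = (fst a, snd (q i))"
      "q (j - 1) = (fst a, mate ?A R a (snd (q i)))"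
      using \<open>inv i\<close> unfolding inv_def by blast
    show ?thesis using q_edge[of i]
    proof (cases rule: lift_edgeE)
      case horizontal
      then show ?thesis unfolding inv_def using inv
        by (intro exI[of _ j] exI[of _ a] exI[of _ w]) auto
    next
      case (vertical b)
      \<comment> \<open>The same letter would put the walk back over the base vertex
        \<open>fst a\<close> in an unchanged fibre coordinate, so \<open>q i = q j\<close> and hence
        \<open>i = j\<close>. The vertical edge would then be retraced at once, giving
        \<open>q (i - 1) = q (Suc i)\<close>, impossible on a cycle of length at least 3.\<close>
      have "b \<noteq> a"
      proof
        assume "b = a"
        then have "q i = q j" unfolding inv(6) by (intro pair) (simp_all add: vertical(2) flip: \<open>b = a\<close>)
        then have "j = i" using q_neq[of j i] inv(2) i by (cases "j = i") auto
        then have "q (i - 1) = (fst b, snd (q (Suc i)))" using inv(7) vertical(4) \<open>b = a\<close> by simp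
        then have "q (i - 1) = q (Suc i)" using pair[OF vertical(3) refl] by simp
        moreover have "i - 1 < Suc i" "Suc i < i - 1 + ?n" using i n by linarith+
        ultimately show False using q_neq by blast
      qed
      \<comment> \<open>The word has length at most \<open>i < ?n \<le> R\<close>, so the cut-off in
        \<open>push\<close> does not apply.\<close>
      then have "fst (snd (q (Suc i))) e = b # a # w"
        using in_words[of i] inv i nR by (simp add: vertical(4) mate_def push_Cons)
      moreover have "q (Suc i - 1) = (fst b, mate ?A R b (snd (q (Suc i))))"
        by (intro pair) (simp_all add: vertical(2,4) mate_mate[OF vertical(1)])
      moreover have "q (Suc i) = (fst b, snd (q (Suc i)))"
        by (rule pair[OF vertical(3) refl])
      moreover have "length (b # a # w) \<le> Suc i" using inv(5) by simp
      ultimately show ?thesis unfolding inv_def using vertical(1)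
        by (intro exI[of _ "Suc i"] exI[of _ b] exI[of _ "a # w"] conjI) (assumption | linarith)+
    qed
  qed
  have "inv i" if "1 \<le> i" "i \<le> ?n" for i
    using that by (induction i rule: dec_induct) (use step1 step in auto)
  then have "inv ?n" using n by simp
  \<comment> \<open>After a full turn the word is nonempty, yet \<open>q ?n = q 0\<close> sends
    \<open>e\<close> to the empty word.\<close>
  then show False unfolding inv_def using e q_n by auto
qed

text \<open>A cycle inside one copy projects to a cycle of the base graph; any other cycle is longer
  than the ball radius, here chosen as \<open>g\<close>.\<close>

lemma has_girth_lift:
  assumes "sgraph V E" "has_girth V E g"
  shows "has_girth (V \<times> fibre (V \<times> {..<k}) g) (lift_edge V E k g) g"
  unfolding has_girth_def
proof (intro conjI allI impI)
  let ?A = "V \<times> {..<k}"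
  obtain cs where cs: "is_cycle V E cs" "length cs = g"
    using assms(2) by (auto simp: has_girth_def)
  let ?h = "\<lambda>v. (v, (id, False))"
  have "is_cycle (V \<times> fibre ?A g) (lift_edge V E k g) (map ?h cs)"
    using cs(1) id_in_fibre[of ?A g]
    by (intro is_cycle_map[OF cs(1)]) (auto simp: inj_on_def lift_edge_def is_cycle_def)
  then show "\<exists>cs. is_cycle (V \<times> fibre ?A g) (lift_edge V E k g) cs \<and> length cs = g"
    using cs(2) by (intro exI[of _ "map ?h cs"]) simp
next
  let ?A = "V \<times> {..<k}"
  fix cs assume cs: "is_cycle (V \<times> fibre ?A g) (lift_edge V E k g) cs"
  show "g \<le> length cs"
  proof (cases "\<forall>p\<in>set cs. \<forall>q\<in>set cs. snd p = snd q")
    case True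
    have "is_cycle V E (map fst cs)"
    proof (rule is_cycle_map[OF cs])
      show "inj_on fst (set cs)" by (rule inj_onI, rule prod_eqI) (use True in blast)+
      show "fst ` set cs \<subseteq> V" using cs by (auto simp: is_cycle_def)
      show "E (fst p) (fst q)" if "p \<in> set cs" "q \<in> set cs" "lift_edge V E k g p q" for p q
        using that(3)
      proof (cases rule: lift_edgeE)
        case (vertical a)
        have "snd p = snd q" using True that by blast
        then show ?thesis using vertical(4) mate_neq(2) by metis
      qed
    qed
    then show ?thesis using assms(2) by (auto simp: has_girth_def)
  next
    case False
    then show ?thesis using lift_cycle_length[OF assms(1) cs] by simp
  qed
qed

section \<open>Colourings of the lift\<close>

lemma colorable_lift_imp_colorable:
  assumes "colorable (V \<times> fibre (V \<times> {..<k}) R) (lift_edge V E k R) m"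
  shows "colorable V E m"
proof -
  obtain c where "proper_coloring (V \<times> fibre (V \<times> {..<k}) R) (lift_edge V E k R) m c"
    using assms by (auto simp: colorable_def)
  \<comment> \<open>Restrict the colouring to the copy of the base graph at the identity.\<close>
  then have "proper_coloring V E m (\<lambda>v. c (v, (id, False)))"
    using id_in_fibre[of "V \<times> {..<k}" R] by (auto simp: proper_coloring_def lift_edge_def)
  then show ?thesis by (auto simp: colorable_def)
qed

text \<open>Horizontal edges see the same rotation at both ends. Vertical edges keep the base vertex
  and flip the Boolean, so the two colours differ by one modulo 3.\<close>

lemma proper_coloring_lift:
  assumes "proper_coloring V E 3 c"
  shows "proper_coloring (V \<times> fibre (V \<times> {..<k}) R) (lift_edge V E k R) 3
    (\<lambda>p. (c (fst p) + of_bool (snd (snd p))) mod 3)"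
  unfolding proper_coloring_def
proof (intro conjI ballI impI)
  let ?A = "V \<times> {..<k}"
  fix p q assume "p \<in> V \<times> fibre ?A R" "q \<in> V \<times> fibre ?A R" and pq: "lift_edge V E k R p q"
  then have V: "fst p \<in> V" "fst q \<in> V" by auto
  then have lt: "c (fst p) < 3" "c (fst q) < 3" using assms by (auto simp: proper_coloring_def)
  show "(c (fst p) + of_bool (snd (snd p))) mod 3 \<noteq> (c (fst q) + of_bool (snd (snd q))) mod 3"
    using pq
  proof (cases rule: lift_edgeE)
    case horizontal
    then have "c (fst p) \<noteq> c (fst q)" using assms V by (auto simp: proper_coloring_def)
    then show ?thesis using horizontal lt by (cases "snd (snd q)") (simp_all, presburger)
  next
    case (vertical a)
    then show ?thesis using lt by (cases "snd (snd p)") (simp_all add: snd_mate, presburger+)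
  qed
qed simp

section \<open>Colour shifts\<close>

text \<open>A vertex map that cyclically shifts the colours forces equal colour classes.\<close>
definition colour_shift :: "'a set \<Rightarrow> ('a \<Rightarrow> nat) \<Rightarrow> ('a \<Rightarrow> 'a) \<Rightarrow> bool" where
  "colour_shift V c \<rho> \<longleftrightarrow> inj_on \<rho> V \<and> \<rho> ` V \<subseteq> V \<and> (\<forall>v\<in>V. c (\<rho> v) = Suc (c v) mod 3)"

lemma colour_shift_lift:
  assumes "colour_shift V c \<rho>"
  shows "colour_shift (V \<times> X) (\<lambda>p. (c (fst p) + of_bool (snd (snd p))) mod 3) (map_prod \<rho> id)"
  using assms by (auto simp: colour_shift_def inj_on_def mod_simps)

lemma equitable_coloring_if_shift:
  assumes "finite V" "proper_coloring V E 3 c" "colour_shift V c \<rho>"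
  shows "equitable_coloring V E 3 c"
proof -
  let ?n = "\<lambda>i. card {v \<in> V. c v = i}"
  have "?n i \<le> ?n (Suc i mod 3)" for i
  proof (rule card_inj_on_le)
    show "inj_on \<rho> {v \<in> V. c v = i}"
      using assms(3) by (auto simp: colour_shift_def inj_on_def)
    show "\<rho> ` {v \<in> V. c v = i} \<subseteq> {v \<in> V. c v = Suc i mod 3}"
      using assms(3) by (auto simp: colour_shift_def)
  qed (use assms(1) in simp)
  \<comment> \<open>The three inequalities form a closed chain, which forces equality.\<close>
  from this[of 0] this[of 1] this[of 2] have "?n 0 = ?n 1" "?n 1 = ?n 2" by (auto simp: numeral_2_eq_2)
  then have eq: "?n i = ?n 0" if "i < 3" for i
    using that by (auto simp: numeral_3_eq_3 numeral_2_eq_2 less_Suc_eq)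
  have "?n i \<le> ?n j + 1" if "i < 3" "j < 3" for i j
    using eq[OF that(1)] eq[OF that(2)] by linarith
  then show ?thesis using assms(2) by (simp add: equitable_coloring_def)
qed

section \<open>Disjoint cycles\<close>

definition cyc_verts :: "nat set \<Rightarrow> (nat \<times> nat \<times> nat) set" where
  "cyc_verts K = {(n, i, j). n \<in> K \<and> i < n \<and> j < 3}"

definition cyc_edge :: "nat set \<Rightarrow> nat \<times> nat \<times> nat \<Rightarrow> nat \<times> nat \<times> nat \<Rightarrow> bool" where
  "cyc_edge K = (\<lambda>(n, i, j) (n', i', j'). n \<in> K \<and> i < n \<and> i' < n \<and> j < 3 \<and> n = n' \<and> j = j' \<and>
     (i' = Suc i mod n \<or> i = Suc i' mod n))"

text \<open>Colours 0 and 1 alternate and the last vertex gets 2, which is proper for lengths of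
  either parity; the copy index \<open>j\<close> rotates the colours.\<close>

definition cyc_colour :: "nat \<times> nat \<times> nat \<Rightarrow> nat" where
  "cyc_colour = (\<lambda>(n, i, j). ((if Suc i = n then 2 else i mod 2) + j) mod 3)"

context
  fixes K :: "nat set"
  assumes K: "finite K" "\<And>n. n \<in> K \<Longrightarrow> 3 \<le> n"
begin

lemma sgraph_cyc: "sgraph (cyc_verts K) (cyc_edge K)"
proof -
  have "cyc_verts K \<subseteq> K \<times> {..<Max K} \<times> {..<3}"
    using K(1) by (auto simp: cyc_verts_def dest: Max_ge[OF K(1)])
  then have "finite (cyc_verts K)" by (rule finite_subset) (simp add: K(1))
  \<comment> \<open>Length 1 must be excluded: there the successor modulo \<open>n\<close> would be
    a loop.\<close>
  then show ?thesis using K(2)[of "Suc 0"]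
    by (auto simp: sgraph_def cyc_verts_def cyc_edge_def mod_Suc split: if_splits intro!: gr0I)
qed

lemma regular_cyc: "regular (cyc_verts K) (cyc_edge K) 2"
  unfolding regular_def
proof
  fix v assume "v \<in> cyc_verts K"
  then obtain n i j where v: "v = (n, i, j)" "n \<in> K" "i < n" "j < 3"
    by (auto simp: cyc_verts_def)
  then have n: "3 \<le> n" using K by simp
  let ?a = "if Suc i = n then 0 else Suc i" and ?b = "if i = 0 then n - 1 else i - 1"
  have "{u \<in> cyc_verts K. cyc_edge K v u} = {(n, ?a, j), (n, ?b, j)}"
    using v n by (auto simp: cyc_verts_def cyc_edge_def mod_Suc split: if_splits)
  moreover have "?a \<noteq> ?b" using v n by auto
  ultimately show "card {u \<in> cyc_verts K. cyc_edge K v u} = 2" by simp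
qed

lemma cyc_edge_Suc:
  "n \<in> K \<Longrightarrow> j < 3 \<Longrightarrow> Suc i < n \<Longrightarrow> cyc_edge K (n, i, j) (n, Suc i, j)"
  by (simp add: cyc_edge_def)

lemma cyc_edge_0: "n \<in> K \<Longrightarrow> j < 3 \<Longrightarrow> cyc_edge K (n, n - 1, j) (n, 0, j)"
  using K(2)[of n] by (simp add: cyc_edge_def)

text \<open>By 2-regularity a cycle contains every neighbour of its vertices, hence a whole
  component, and components have at least \<open>g\<close> vertices.\<close>

lemma has_girth_cyc:
  assumes "g \<in> K" "\<And>n. n \<in> K \<Longrightarrow> g \<le> n"
  shows "has_girth (cyc_verts K) (cyc_edge K) g"
  unfolding has_girth_def
proof (intro conjI allI impI)
  let ?cs = "map (\<lambda>i. (g, i, 0)) [0..<g]"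
  have "3 \<le> g" using K(2) assms by simp
  then have "is_cycle (cyc_verts K) (cyc_edge K) ?cs"
    using assms(1) cyc_edge_Suc[of g 0] cyc_edge_0[of g 0]
    by (auto simp: is_cycle_def distinct_map inj_on_def cyc_verts_def last_map hd_map)
  then show "\<exists>cs. is_cycle (cyc_verts K) (cyc_edge K) cs \<and> length cs = g"
    by (intro exI[of _ ?cs]) simp
next
  fix cs assume cs: "is_cycle (cyc_verts K) (cyc_edge K) cs"
  then have "cs \<noteq> []" "set cs \<subseteq> cyc_verts K" by (auto simp: is_cycle_def)
  then obtain v where v: "v \<in> set cs" "v \<in> cyc_verts K" by (cases cs) auto
  obtain n i j where nij: "v = (n, i, j)" "n \<in> K" "i < n" "j < 3"
    using v(2) by (auto simp: cyc_verts_def)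
  note closed = is_cycle_closed_if_2_regular[OF sgraph_cyc regular_cyc cs]
  \<comment> \<open>Used twice: from the given position up to \<open>n - 1\<close>, and, after
    wrapping round, from 0 through all positions.\<close>
  have up: "(n, m, j) \<in> set cs" if "i \<le> m" "m < n" "(n, i, j) \<in> set cs" for i m
    using that
    by (induction m rule: dec_induct) (use closed cyc_edge_Suc nij in \<open>auto intro: Suc_lessD\<close>)
  have "(n, n - 1, j) \<in> set cs" using up[of i "n - 1"] v(1) nij by simp
  then have "(n, 0, j) \<in> set cs" using closed cyc_edge_0 nij by blast
  then have "(\<lambda>m. (n, m, j)) ` {..<n} \<subseteq> set cs" using up[of 0] by auto
  then have "card ((\<lambda>m. (n, m, j)) ` {..<n}) \<le> card (set cs)" by (intro card_mono) auto
  then have "n \<le> card (set cs)" by (simp add: card_image inj_on_def)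
  also have "\<dots> \<le> length cs" by (rule card_length)
  finally show "g \<le> length cs" using assms(2)[OF nij(2)] by simp
qed

lemma not_colorable_cyc:
  assumes "n \<in> K" "odd n"
  shows "\<not> colorable (cyc_verts K) (cyc_edge K) 2"
proof
  assume "colorable (cyc_verts K) (cyc_edge K) 2"
  then obtain c where c: "proper_coloring (cyc_verts K) (cyc_edge K) 2 c"
    by (auto simp: colorable_def)
  let ?c = "\<lambda>i. c (n, i, 0)"
  have V: "(n, i, 0) \<in> cyc_verts K" if "i < n" for i
    using that assms by (simp add: cyc_verts_def)
  have lt: "?c i < 2" if "i < n" for i
    using c V[OF that] by (simp add: proper_coloring_def)
  have "?c i = (?c 0 + i) mod 2" if "i < n" for i
    using that
  proof (induction i)
    case 0
    then show ?case using lt by simp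
  next
    case (Suc i)
    have "?c i \<noteq> ?c (Suc i)"
      using c V[of i] V[of "Suc i"] cyc_edge_Suc[of n 0 i] Suc.prems assms(1)
      by (simp add: proper_coloring_def)
    then show ?case using Suc lt[of "Suc i"] lt[of i] by simp presburger
  qed
  from this[of "n - 1"] have "?c (n - 1) = ?c 0"
    using assms K(2)[of n] lt[of 0] by (auto elim!: oddE)
  moreover have "?c (n - 1) \<noteq> ?c 0"
    using c V[of 0] V[of "n - 1"] cyc_edge_0[of n 0] assms(1) K(2)[of n]
    by (simp add: proper_coloring_def)
  ultimately show False by simp
qed

lemma proper_coloring_cyc: "proper_coloring (cyc_verts K) (cyc_edge K) 3 cyc_colour"
proof -
  have cancel: "a = b" if "(a + j) mod 3 = (b + j) mod 3" "a < 3" "b < 3" for a b j :: nat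
    using that by presburger
  have "cyc_colour u \<noteq> cyc_colour v" if "cyc_edge K u v" for u v
  proof -
    obtain n i i' j where uv: "u = (n, i, j)" "v = (n, i', j)" "n \<in> K" "i < n" "i' < n"
      "i' = Suc i mod n \<or> i = Suc i' mod n"
      using \<open>cyc_edge K u v\<close> by (auto simp: cyc_edge_def)
    let ?f = "\<lambda>i. if Suc i = n then 2 else i mod 2"
    have "?f i \<noteq> ?f i'" using uv(4-) K(2)[OF uv(3)]
      by (auto simp: mod_Suc split: if_splits)
    moreover have "?f i < 3" "?f i' < 3" by (auto simp: less_Suc_eq)
    ultimately show ?thesis using cancel[of "?f i" j "?f i'"] by (auto simp: uv cyc_colour_def)
  qed
  moreover have "cyc_colour v < 3" for v by (simp add: cyc_colour_def split: prod.split)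
  ultimately show ?thesis by (auto simp: proper_coloring_def)
qed

lemma colour_shift_cyc:
  "colour_shift (cyc_verts K) cyc_colour (\<lambda>(n, i, j). (n, i, Suc j mod 3))"
  by (auto simp: colour_shift_def cyc_verts_def cyc_colour_def inj_on_def mod_simps mod_Suc
      split: if_splits)

end

section \<open>Relabelling\<close>

text \<open>The lift lives on a nested product type; this transports it to vertices in
  \<open>nat\<close>.\<close>

lemma rgchi_equitable_relabel:
  assumes "rgchi_equitable V E r g k" "inj_on f V"
  shows "rgchi_equitable (f ` V) (\<lambda>x y. \<exists>u\<in>V. \<exists>v\<in>V. x = f u \<and> y = f v \<and> E u v) r g k"
proof -
  let ?E = "\<lambda>x y. \<exists>u\<in>V. \<exists>v\<in>V. x = f u \<and> y = f v \<and> E u v"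
  let ?h = "inv_into V f"
  have edge: "?E (f u) (f v) \<longleftrightarrow> E u v" if "u \<in> V" "v \<in> V" for u v
    using that inj_on_eq_iff[OF assms(2)] by blast
  have sg: "sgraph V E" and reg: "regular V E r" and girth: "has_girth V E g"
    and chi: "colorable V E k" "\<not> colorable V E (k - 1)"
    using assms(1) by (auto simp: rgchi_equitable_def rgchi_graph_def rg_graph_def
        chromatic_number_eq_def)
  obtain c where c: "equitable_coloring V E k c"
    using assms(1) by (auto simp: rgchi_equitable_def)
  have card_eq: "card {x \<in> f ` V. P x} = card {v \<in> V. P (f v)}" for P
  proof -
    have "{x \<in> f ` V. P x} = f ` {v \<in> V. P (f v)}" by auto
    then show ?thesis by (simp add: card_image inj_on_subset[OF assms(2)])
  qed
  have "sgraph (f ` V) ?E"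
    unfolding sgraph_def
  proof (intro conjI allI impI notI)
    fix x
    assume "?E x x"
    then show False using sg inj_onD[OF assms(2)] unfolding sgraph_def by metis
  next
    fix x y
    assume "?E x y"
    then show "?E y x" using sg unfolding sgraph_def by blast
  qed (use sg in \<open>auto simp: sgraph_def\<close>)
  moreover have "regular (f ` V) ?E r"
    unfolding regular_def
  proof
    fix x assume "x \<in> f ` V"
    then obtain v where v: "v \<in> V" "x = f v" by auto
    have "card {y \<in> f ` V. ?E x y} = card {u \<in> V. ?E x (f u)}" by (rule card_eq)
    also have "{u \<in> V. ?E x (f u)} = {u \<in> V. E v u}" using edge v by auto
    finally show "card {y \<in> f ` V. ?E x y} = r" using reg v by (simp add: regular_def)
  qed
  moreover have "has_girth (f ` V) ?E g"
    unfolding has_girth_def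
  proof (intro conjI allI impI)
    obtain cs where cs: "is_cycle V E cs" "length cs = g"
      using girth by (auto simp: has_girth_def)
    then have sub: "set cs \<subseteq> V" by (simp add: is_cycle_def)
    have "is_cycle (f ` V) ?E (map f cs)"
    proof (rule is_cycle_map[OF cs(1) inj_on_subset[OF assms(2) sub] image_mono[OF sub]])
      show "?E (f x) (f y)" if "x \<in> set cs" "y \<in> set cs" "E x y" for x y
        using that sub edge[of x y] by auto
    qed
    then show "\<exists>cs. is_cycle (f ` V) ?E cs \<and> length cs = g"
      using cs(2) by (intro exI[of _ "map f cs"]) simp
  next
    fix cs assume cs: "is_cycle (f ` V) ?E cs"
    then have sub: "set cs \<subseteq> f ` V" by (simp add: is_cycle_def)
    then have "is_cycle V E (map ?h cs)"
      by (intro is_cycle_map[OF cs] inj_on_inv_into)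
        (auto simp: inv_into_f_f[OF assms(2)] intro: inv_into_into)
    then show "g \<le> length cs" using girth by (auto simp: has_girth_def)
  qed
  moreover have "\<not> colorable (f ` V) ?E (k - 1)"
  proof
    assume "colorable (f ` V) ?E (k - 1)"
    then obtain d where "proper_coloring (f ` V) ?E (k - 1) d" by (auto simp: colorable_def)
    then have d: "\<forall>v\<in>V. d (f v) < k - 1"
      "\<And>x y. x \<in> V \<Longrightarrow> y \<in> V \<Longrightarrow> ?E (f x) (f y) \<Longrightarrow> d (f x) \<noteq> d (f y)"
      unfolding proper_coloring_def by blast+
    then have "proper_coloring V E (k - 1) (d \<circ> f)"
      by (simp add: proper_coloring_def edge del: bex_simps)
    then show False using chi(2) by (auto simp: colorable_def)
  qed
  moreover have eq: "equitable_coloring (f ` V) ?E k (c \<circ> ?h)"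
  proof -
    have "{v \<in> V. (c \<circ> ?h) (f v) = i} = {v \<in> V. c v = i}" for i using assms(2) by auto
    then have "card {x \<in> f ` V. (c \<circ> ?h) x = i} = card {v \<in> V. c v = i}" for i
      using card_eq[of "\<lambda>x. (c \<circ> ?h) x = i"] by simp
    moreover have "proper_coloring (f ` V) ?E k (c \<circ> ?h)"
      using c assms(2)
      by (simp add: equitable_coloring_def proper_coloring_def edge del: bex_simps)
    ultimately show ?thesis using c by (simp add: equitable_coloring_def)
  qed
  moreover have "colorable (f ` V) ?E k"
    using eq by (auto simp: equitable_coloring_def colorable_def)
  ultimately show ?thesis
    by (auto simp: rgchi_equitable_def rgchi_graph_def rg_graph_def chromatic_number_eq_def)
qed

section \<open>Assembling the graph\<close>

theorem theorem5p1:
  assumes "\<forall>r g (V :: nat set) E. r \<ge> 2 \<and> g \<ge> 4 \<and> even g \<and> cage V E r g \<longrightarrow> bipartite V E"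
  shows "\<forall>r g. r \<ge> 2 \<and> g \<ge> 3 \<longrightarrow> (\<exists>(V :: nat set) E. rgchi_equitable V E r g 3)"
proof (intro allI impI)
  fix r g :: nat assume rg: "r \<ge> 2 \<and> g \<ge> 3"
  \<comment> \<open>The shorter length fixes the girth; one of the two is odd and rules out a
    2-colouring.\<close>
  define K where "K = {g, Suc g}"
  define B where "B = cyc_verts K"
  define F where "F = cyc_edge K"
  \<comment> \<open>The base graph is 2-regular, so each vertex needs \<open>r - 2\<close>
    letters.\<close>
  define V where "V = B \<times> fibre (B \<times> {..<r - 2}) g"
  define E where "E = lift_edge B F (r - 2) g"
  have K: "finite K" "\<And>n. n \<in> K \<Longrightarrow> 3 \<le> n" using rg by (auto simp: K_def)
  have B: "sgraph B F" "regular B F 2" "has_girth B F g"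
    unfolding B_def F_def
    by (intro sgraph_cyc regular_cyc has_girth_cyc K; auto simp: K_def)+
  obtain n where "n \<in> K" "odd n" unfolding K_def by (metis even_Suc insertCI)
  then have "\<not> colorable B F 2" using not_colorable_cyc[OF K] by (simp add: B_def F_def)
  then have nc: "\<not> colorable V E 2"
    using colorable_lift_imp_colorable[of B "r - 2" g F 2] by (auto simp: V_def E_def)
  have sg: "sgraph V E" unfolding V_def E_def by (rule sgraph_lift[OF B(1)])
  have reg: "regular V E r"
    using regular_lift[OF B(1,2), of g "r - 2"] rg
    by (simp add: V_def E_def del: add_2_eq_Suc)
  have girth: "has_girth V E g" unfolding V_def E_def by (rule has_girth_lift[OF B(1,3)])
  have "proper_coloring B F 3 cyc_colour" unfolding B_def F_def by (rule proper_coloring_cyc[OF K])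
  note col = proper_coloring_lift[OF this, of "r - 2" g, folded V_def E_def]
  have "colour_shift B cyc_colour (\<lambda>(n, i, j). (n, i, Suc j mod 3))"
    unfolding B_def by (rule colour_shift_cyc[OF K])
  note shift = colour_shift_lift[OF this, of "fibre (B \<times> {..<r - 2}) g", folded V_def]
  have fin: "finite V" using sg by (simp add: sgraph_def)
  have eq: "rgchi_equitable V E r g 3"
    using sg reg girth nc col equitable_coloring_if_shift[OF fin col shift]
    by (auto simp: rgchi_equitable_def rgchi_graph_def rg_graph_def chromatic_number_eq_def
        colorable_def)
  obtain f :: "_ \<Rightarrow> nat" where "inj_on f V" using finite_imp_inj_to_nat_seg[OF fin] by blast
  then show "\<exists>(V :: nat set) E. rgchi_equitable V E r g 3"
    using rgchi_equitable_relabel[OF eq] by blast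
qed

end
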